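(* Let $\mathbf{A}\in\mathcal{L}_{\mathrm{TV}}^{n,n}$ and $\mathbf{B}\in\mathcal{L}_{\mathrm{TV}}^{n,p}$, and consider the system $\mathbf{x} = \mathbf{S}_+\mathbf{A}\mathbf{x} + \mathbf{S}_+\mathbf{B}\mathbf{u} + \mathbf{S}_+\mathbf{w}$, $x_0=0$. Let $\boldsymbol{\Phi}_x,\boldsymbol{\Phi}_u$ be strictly causal, linear, $\ell_\infty$-stable operators satisfying $$\begin{bmatrix} I-\mathbf{S}_+\mathbf{A} & -\mathbf{S}_+\mathbf{B}\end{bmatrix}\begin{bmatrix}\boldsymbol{\Phi}_x\\ \boldsymbol{\Phi}_u\end{bmatrix}=\mathbf{S}_+ .$$ Then the controller implementation described by $$\mathbf{u}=\boldsymbol{\Phi}_u\mathbf{S}_-\hat{\mathbf{w}},\qquad \hat{\mathbf{w}}=\mathbf{x}-\hat{\mathbf{x}},\ \ \hat w_0=0,\qquad \hat{\mathbf{x}}=(\boldsymbol{\Phi}_x\mathbf{S}_--I)\hat{\mathbf{w}}$$ is $\ell_\infty$-stabilizing. In particular, the resulting closed loop map $(\mathbf{w},\boldsymbol{\delta}_y,\boldsymbol{\delta}_u)\mapsto(\mathbf{x},\mathbf{u},\hat{\mathbf{w}})$ is $\ell_\infty$-stable, and (when $\boldsymbol{\delta}_y=0$, $\boldsymbol{\delta}_u=0$) the closed loop response $$\begin{bmatrix}\mathbf{x}\\ \mathbf{u}\end{bmatrix}=\begin{bmatrix}\boldsymbol{\Phi}_x\\ \boldsymbol{\Phi}_u\end{bmatrix}\mathbf{w}$$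 is achieved.
   Context: Signals: $\ell^q_{\infty,e}$ is the space of all $q$-tuples of real sequences, i.e. sequences $\mathbf{x}=(x_t)_{t=0}^\infty$ with $x_t\in\mathbb{R}^q$; $\ell^q_\infty$ is the subspace of bounded ones, with norm $\|\mathbf{x}\|_{\ell_\infty}=\max_i\sup_t|x^i_t|$. Operators: $\mathbf{S}_+$ is the right shift $\mathbf{S}_+(x_0,x_1,\dots)=(0,x_0,x_1,\dots)$ and $\mathbf{S}_-$ the left shift $\mathbf{S}_-(x_0,x_1,\dots)=(x_1,x_2,\dots)$. $\mathcal{L}_{\mathrm{TV}}^{p,q}$ is the space of bounded linear causal operators $\ell^q_\infty\to\ell^p_\infty$, with induced norm $\|\mathbf{R}\|_{\ell_\infty\to\ell_\infty}=\sup_{\|\mathbf{x}\|_{\ell_\infty}\le 1}\|\mathbf{R}\mathbf{x}\|_{\ell_\infty}$. Each such operator is represented by a block lower-triangular pulse response matrix and so also acts on the extended spaces. A linear causal operator is strictly causal if its output at time $t$ depends only on inputs at times strictly less than $t$. A linear map between extended spaces is $\ell_\infty$-stable if it is causal, takes bounded signals to bounded signals, and has finite induced norm, i.e. it defines an element of $\mathcal{L}_{\mathrm{TV}}$. Here $\boldsymbol{\Phi}_x\in\mathcal{L}_{\mathrm{TV}}^{n,n}$ and $\boldsymbol{\Phi}_u\in\mathcal{L}_{\mathrm{TV}}^{p,n}$. Perturbed interconnection: a perturbation $\boldsymbol{\delta}_y$ is added to the measurement $\mathbf{x}$ entering the controller and $\boldsymbol{\delta}_u$ is added to the controller output, giving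 $$\mathbf{x}=\mathbf{S}_+\mathbf{A}\mathbf{x}+\mathbf{S}_+\mathbf{B}\mathbf{u}+\mathbf{S}_+\mathbf{w},\ x_0=0,\qquad \mathbf{u}=\boldsymbol{\Phi}_u\mathbf{S}_-\hat{\mathbf{w}}+\boldsymbol{\delta}_u,\qquad \hat{\mathbf{w}}=\mathbf{x}+\boldsymbol{\delta}_y+(I-\boldsymbol{\Phi}_x\mathbf{S}_-)\hat{\mathbf{w}},\ \hat w_0=0,$$ where $\hat w_0=0$ is an imposed initial condition, the last equation being understood at times $t\ge1$. The controller implementation is $\ell_\infty$-stabilizing if this interconnection is well posed (the equations have a unique solution in the extended spaces for all inputs in the extended spaces) and the resulting map $(\mathbf{w},\boldsymbol{\delta}_y,\boldsymbol{\delta}_u)\mapsto(\mathbf{x},\mathbf{u},\hat{\mathbf{w}})$ is $\ell_\infty$-stable. *)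

theory Defs
  imports "HOL-Analysis.Analysis" "HOL-Library.Function_Algebras"
begin

type_synonym 'q signal = "nat \<Rightarrow> real^'q"

definition linf :: "'q::finite signal set" where
  "linf = {x. \<forall>i. bounded (range (\<lambda>t. x t $ i))}"

text \<open>Meaningful on \<^const>\<open>linf\<close> only: outside it the supremum is unspecified.\<close>

definition linf_norm :: "'q::finite signal \<Rightarrow> real" where
  "linf_norm x = Max (range (\<lambda>i. SUP t. \<bar>x t $ i\<bar>))"

definition right_shift :: "'q::finite signal \<Rightarrow> 'q signal" where
  "right_shift x = (\<lambda>t. case t of 0 \<Rightarrow> 0 | Suc s \<Rightarrow> x s)"

definition left_shift :: "'q::finite signal \<Rightarrow> 'q signal" where
  "left_shift x = (\<lambda>t. x (Suc t))"

text \<open>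
  An operator is a HOL function on all signals; the following properties are relative to
  a domain \<open>S\<close>, which is either \<^const>\<open>linf\<close> or, for the extended space, \<^const>\<open>UNIV\<close>.
\<close>

definition linear_op_on :: "'q::finite signal set \<Rightarrow> ('q signal \<Rightarrow> 'p::finite signal) \<Rightarrow> bool" where
  "linear_op_on S R \<longleftrightarrow>
     (\<forall>x\<in>S. \<forall>y\<in>S. R (x + y) = R x + R y) \<and>
     (\<forall>c. \<forall>x\<in>S. R (\<lambda>t. c *\<^sub>R x t) = (\<lambda>t. c *\<^sub>R R x t))"

definition causal_on :: "'q::finite signal set \<Rightarrow> ('q signal \<Rightarrow> 'p::finite signal) \<Rightarrow> bool" where
  "causal_on S R \<longleftrightarrow>
     (\<forall>x\<in>S. \<forall>y\<in>S. \<forall>t. (\<forall>s\<le>t. x s = y s) \<longrightarrow> R x t = R y t)"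

definition strictly_causal_on ::
    "'q::finite signal set \<Rightarrow> ('q signal \<Rightarrow> 'p::finite signal) \<Rightarrow> bool" where
  "strictly_causal_on S R \<longleftrightarrow>
     (\<forall>x\<in>S. \<forall>y\<in>S. \<forall>t. (\<forall>s<t. x s = y s) \<longrightarrow> R x t = R y t)"

definition finite_induced_norm :: "('q::finite signal \<Rightarrow> 'p::finite signal) \<Rightarrow> bool" where
  "finite_induced_norm R \<longleftrightarrow> bdd_above ((\<lambda>x. linf_norm (R x)) ` {x \<in> linf. linf_norm x \<le> 1})"

text \<open>
  Bounded linear causal operators from \<^const>\<open>linf\<close> to \<^const>\<open>linf\<close>. Values at unbounded
  signals are unconstrained; the action on the extended space is \<open>extend\<close> below.
\<close>

definition LTV :: "('q::finite signal \<Rightarrow> 'p::finite signal) set" where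
  "LTV = {R. R ` linf \<subseteq> linf \<and> linear_op_on linf R \<and> causal_on linf R \<and> finite_induced_norm R}"

text \<open>Block \<open>(t, s)\<close>: the response at time \<open>t\<close> to unit pulses applied at time \<open>s\<close>.\<close>

definition pulse_response ::
    "('q::finite signal \<Rightarrow> 'p::finite signal) \<Rightarrow> nat \<Rightarrow> nat \<Rightarrow> real^'q^'p" where
  "pulse_response R t s = (\<chi> i j. R (\<lambda>r. if r = s then axis j 1 else 0) t $ i)"

definition extend :: "('q::finite signal \<Rightarrow> 'p::finite signal) \<Rightarrow> 'q signal \<Rightarrow> 'p signal" where
  "extend R x = (\<lambda>t. \<Sum>s\<le>t. pulse_response R t s *v x s)"

lemma zero_in_linf: "0 \<in> linf"
  by (auto simp: linf_def)

lemma finite_support_in_linf: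
  fixes x :: "'q::finite signal"
  assumes "\<And>t. t \<ge> m \<Longrightarrow> x t = 0"
  shows "x \<in> linf"
proof -
  have "finite (range (\<lambda>t. x t $ i))" for i
  proof (rule finite_subset)
    show "range (\<lambda>t. x t $ i) \<subseteq> insert 0 ((\<lambda>t. x t $ i) ` {..<m})"
      using assms by (force simp: not_less[symmetric])
  qed simp
  then show ?thesis by (simp add: linf_def finite_imp_bounded)
qed

lemma linear_op_on_sum:
  assumes R: "linear_op_on linf R" and "finite I"
    and f: "\<And>i. i \<in> I \<Longrightarrow> f i \<in> linf" and "\<And>J. J \<subseteq> I \<Longrightarrow> (\<Sum>i\<in>J. f i) \<in> linf"
  shows "R (\<Sum>i\<in>I. f i) = (\<Sum>i\<in>I. R (f i))"
  using assms(2,3,4)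
proof (induction I rule: finite_induct)
  case empty
  have "R (\<lambda>t. 0 *\<^sub>R (0::'a signal) t) = (\<lambda>t. 0 *\<^sub>R R 0 t)"
    using R zero_in_linf unfolding linear_op_on_def by blast
  then show ?case by (simp add: zero_fun_def)
next
  case (insert i I)
  have "R (f i + (\<Sum>i\<in>I. f i)) = R (f i) + R (\<Sum>i\<in>I. f i)"
    using R insert.prems(1)[of i] insert.prems(2)[of I] unfolding linear_op_on_def by blast
  moreover have "R (\<Sum>i\<in>I. f i) = (\<Sum>i\<in>I. R (f i))"
    by (rule insert.IH) (use insert.prems in auto)
  ultimately show ?case by (simp only: sum.insert[OF insert.hyps])
qed

lemma sum_signal_apply: "(\<Sum>i\<in>I. f i) t = (\<Sum>i\<in>I. (f i :: 'q::finite signal) t)"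
  by (induction I rule: infinite_finite_induct) auto

lemma extend_eq:
  fixes R :: "'q::finite signal \<Rightarrow> 'p::finite signal"
  assumes R: "R \<in> LTV" and x: "x \<in> linf"
  shows "extend R x = R x"
proof
  fix t :: nat
  let ?p = "\<lambda>(s :: nat, j :: 'q) (r :: nat). if r = s then axis j 1 else (0 :: real^'q)"
  let ?I = "{..t} \<times> (UNIV :: 'q set)"
  let ?f = "\<lambda>(k :: nat \<times> 'q) r. (x (fst k) $ snd k) *\<^sub>R ?p k r"
  have lin: "linear_op_on linf R" and cau: "causal_on linf R"
    using R by (auto simp: LTV_def)
  have p: "?p k \<in> linf" for k
    by (rule finite_support_in_linf[of "Suc (fst k)"]) (auto split: prod.splits)
  have f: "(\<Sum>k\<in>J. ?f k) \<in> linf" if "J \<subseteq> ?I" for J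
  proof (rule finite_support_in_linf[of "Suc t"])
    fix r assume "r \<ge> Suc t"
    then show "(\<Sum>k\<in>J. ?f k) r = 0"
      using that by (auto simp: sum_signal_apply intro!: sum.neutral)
  qed
  have fk: "?f k \<in> linf" if "k \<in> ?I" for k
    using f[of "{k}"] that by simp
  have "x r = (\<Sum>k\<in>?I. ?f k) r" if "r \<le> t" for r
  proof -
    have "(\<Sum>k\<in>?I. ?f k) r = (\<Sum>s\<le>t. \<Sum>j\<in>UNIV. if r = s then (x s $ j) *\<^sub>R axis j 1 else 0)"
      unfolding sum_signal_apply sum.cartesian_product by (intro sum.cong) auto
    also have "\<dots> = (\<Sum>s\<le>t. if r = s then \<Sum>j\<in>UNIV. (x s $ j) *\<^sub>R axis j 1 else 0)"
      by (intro sum.cong) auto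
    also have "\<dots> = (\<Sum>j\<in>UNIV. (x r $ j) *\<^sub>R axis j 1)"
      using that by simp
    also have "\<dots> = x r"
      using basis_expansion[of "x r"] by (simp add: scalar_mult_eq_scaleR)
    finally show ?thesis by simp
  qed
  then have "R x t = R (\<Sum>k\<in>?I. ?f k) t"
    using cau x f[of ?I] unfolding causal_on_def by blast
  also have "R (\<Sum>k\<in>?I. ?f k) = (\<Sum>k\<in>?I. R (?f k))"
    by (rule linear_op_on_sum[OF lin]) (use f fk in auto)
  also have "\<dots> = (\<Sum>k\<in>?I. (\<lambda>r. (x (fst k) $ snd k) *\<^sub>R R (?p k) r))"
    using lin p unfolding linear_op_on_def by (intro sum.cong) auto
  also have "\<dots> t = (\<Sum>s\<le>t. \<Sum>j\<in>UNIV. (x s $ j) *\<^sub>R R (?p (s, j)) t)"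
    unfolding sum_signal_apply sum.cartesian_product by (intro sum.cong) auto
  also have "\<dots> = extend R x t"
    unfolding extend_def
    by (intro sum.cong)
       (auto simp: vec_eq_iff pulse_response_def matrix_vector_mult_def mult.commute)
  finally show "extend R x t = R x t" by simp
qed

definition linf_stable :: "('q::finite signal \<Rightarrow> 'p::finite signal) \<Rightarrow> bool" where
  "linf_stable T \<longleftrightarrow> linear_op_on UNIV T \<and> causal_on UNIV T \<and>
     T ` linf \<subseteq> linf \<and> finite_induced_norm T"

lemma linf_stable_LTV:
  "linf_stable T \<longleftrightarrow> linear_op_on UNIV T \<and> causal_on UNIV T \<and> T \<in> LTV"
  unfolding linf_stable_def LTV_def linear_op_on_def causal_on_def by auto

definition plant ::
    "('n::finite signal \<Rightarrow> 'n signal) \<Rightarrow> ('p::finite signal \<Rightarrow> 'n signal) \<Rightarrow>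
     'n signal \<Rightarrow> 'n signal \<Rightarrow> 'p signal \<Rightarrow> bool" where
  "plant A B w x u \<longleftrightarrow>
     x = right_shift (extend A x) + right_shift (extend B u) + right_shift w \<and> x 0 = 0"

text \<open>
  \<open>y\<close> is the measurement fed to the controller and \<open>v\<close> its output; nominally
  \<open>y = x\<close> and \<open>u = v\<close>. At time 0 the imposed value of \<open>wh\<close> replaces the
  equation \<open>wh = y - xh\<close>, which a nonzero \<open>y 0\<close> would contradict.
\<close>

definition controller ::
    "('n::finite signal \<Rightarrow> 'n signal) \<Rightarrow> ('n signal \<Rightarrow> 'p::finite signal) \<Rightarrow>
     'n signal \<Rightarrow> 'p signal \<Rightarrow> 'n signal \<Rightarrow> 'n signal \<Rightarrow> bool" where
  "controller \<Phi>x \<Phi>u y v wh xh \<longleftrightarrow>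
     v = \<Phi>u (left_shift wh) \<and>
     wh 0 = 0 \<and> (\<forall>t\<ge>1. wh t = y t - xh t) \<and>
     xh = \<Phi>x (left_shift wh) - wh"

definition interconnection ::
    "('n::finite signal \<Rightarrow> 'n signal) \<Rightarrow> ('p::finite signal \<Rightarrow> 'n signal) \<Rightarrow>
     ('n signal \<Rightarrow> 'n signal) \<Rightarrow> ('n signal \<Rightarrow> 'p signal) \<Rightarrow>
     'n signal \<Rightarrow> 'n signal \<Rightarrow> 'p signal \<Rightarrow> 'n signal \<Rightarrow> 'p signal \<Rightarrow> 'n signal \<Rightarrow> bool" where
  "interconnection A B \<Phi>x \<Phi>u w \<delta>y \<delta>u x u wh \<longleftrightarrow>
     plant A B w x u \<and> (\<exists>v xh. controller \<Phi>x \<Phi>u (x + \<delta>y) v wh xh \<and> u = v + \<delta>u)"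

lemma interconnection_iff:
  "interconnection A B \<Phi>x \<Phi>u w \<delta>y \<delta>u x u wh \<longleftrightarrow>
     x = right_shift (extend A x) + right_shift (extend B u) + right_shift w \<and> x 0 = 0 \<and>
     u = \<Phi>u (left_shift wh) + \<delta>u \<and>
     (\<forall>t\<ge>1. wh t = x t + \<delta>y t + (wh t - \<Phi>x (left_shift wh) t)) \<and> wh 0 = 0"
proof -
  have "wh t = x t + \<delta>y t - (\<Phi>x (left_shift wh) - wh) t \<longleftrightarrow>
        wh t = x t + \<delta>y t + (wh t - \<Phi>x (left_shift wh) t)" for t
    by (simp add: algebra_simps)
  then show ?thesis
    unfolding interconnection_def plant_def controller_def plus_fun_apply by blast
qed

definition well_posed ::
    "('n::finite signal \<Rightarrow> 'n signal) \<Rightarrow> ('p::finite signal \<Rightarrow> 'n signal) \<Rightarrow>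
     ('n signal \<Rightarrow> 'n signal) \<Rightarrow> ('n signal \<Rightarrow> 'p signal) \<Rightarrow> bool" where
  "well_posed A B \<Phi>x \<Phi>u \<longleftrightarrow>
     (\<forall>w \<delta>y \<delta>u. \<exists>!(x, u, wh). interconnection A B \<Phi>x \<Phi>u w \<delta>y \<delta>u x u wh)"

text \<open>
  Tuples of signals are stacked into one signal whose channels are indexed by the sum type,
  so that \<^const>\<open>linf_norm\<close> of a stacked signal is the maximum over all channels.
\<close>

definition stack :: "'a::finite signal \<Rightarrow> 'b::finite signal \<Rightarrow> ('a + 'b) signal" where
  "stack x y = (\<lambda>t. \<chi> k. case k of Inl i \<Rightarrow> x t $ i | Inr j \<Rightarrow> y t $ j)"

definition upper :: "('a::finite + 'b::finite) signal \<Rightarrow> 'a signal" where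
  "upper z = (\<lambda>t. \<chi> i. z t $ Inl i)"

definition lower :: "('a::finite + 'b::finite) signal \<Rightarrow> 'b signal" where
  "lower z = (\<lambda>t. \<chi> j. z t $ Inr j)"

lemma stack_simps: "upper (stack x y) = x" "lower (stack x y) = y" "stack (upper z) (lower z) = z"
  by (auto simp: stack_def upper_def lower_def fun_eq_iff vec_eq_iff split: sum.split)

text \<open>The map from \<open>(w, \<delta>y, \<delta>u)\<close> to \<open>(x, u, wh)\<close>; meaningful if \<^const>\<open>well_posed\<close> holds.\<close>

definition closed_loop_map ::
    "('n::finite signal \<Rightarrow> 'n signal) \<Rightarrow> ('p::finite signal \<Rightarrow> 'n signal) \<Rightarrow>
     ('n signal \<Rightarrow> 'n signal) \<Rightarrow> ('n signal \<Rightarrow> 'p signal) \<Rightarrow>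
     ('n + 'n + 'p) signal \<Rightarrow> ('n + 'p + 'n) signal" where
  "closed_loop_map A B \<Phi>x \<Phi>u d =
     (case (THE (x, u, wh). interconnection A B \<Phi>x \<Phi>u
              (upper d) (upper (lower d)) (lower (lower d)) x u wh) of
        (x, u, wh) \<Rightarrow> stack x (stack u wh))"

definition linf_stabilizing ::
    "('n::finite signal \<Rightarrow> 'n signal) \<Rightarrow> ('p::finite signal \<Rightarrow> 'n signal) \<Rightarrow>
     ('n signal \<Rightarrow> 'n signal) \<Rightarrow> ('n signal \<Rightarrow> 'p signal) \<Rightarrow> bool" where
  "linf_stabilizing A B \<Phi>x \<Phi>u \<longleftrightarrow>
     well_posed A B \<Phi>x \<Phi>u \<and> linf_stable (closed_loop_map A B \<Phi>x \<Phi>u)"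

end

theory Submission imports Defs begin

text \<open>
  Write \<open>S\<close> and \<open>L\<close> for the right and left shift, \<open>z = L wh\<close> and \<open>\<delta> = S L \<delta>y\<close>, which is \<open>\<delta>y\<close>
  with its time 0 value removed. By strict causality \<open>\<Phi>x z\<close> vanishes at time 0, so the equation for
  \<open>wh\<close> says \<open>\<Phi>x z = x + \<delta>\<close>. Inserting this and \<open>\<Phi>u z = u - \<delta>u\<close> into the constraint
  \<open>\<Phi>x z - S A \<Phi>x z - S B \<Phi>u z = S z\<close> and eliminating \<open>x\<close> with the plant equation gives
  \<open>z = w + L \<delta>y - A \<delta> + B \<delta>u\<close>. Hence the closed loop has the unique solution
  \<open>x = \<Phi>x z - \<delta>\<close>, \<open>u = \<Phi>u z + \<delta>u\<close>, \<open>wh = S z\<close>. The term \<open>L \<delta>y\<close> in \<open>z\<close> looks one step ahead,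
  but \<open>z\<close> enters only through strictly causal operators, so the closed loop map is causal.
\<close>

section \<open>Entrywise bounds for signals and operators\<close>

lemma linf_iff: "x \<in> linf \<longleftrightarrow> (\<exists>c. \<forall>t i. \<bar>x t $ i\<bar> \<le> c)"
proof
  assume "x \<in> linf"
  then have "\<forall>i. \<exists>c. \<forall>t. \<bar>x t $ i\<bar> \<le> c"
    by (auto simp: linf_def bounded_iff)
  then obtain c where c: "\<bar>x t $ i\<bar> \<le> c i" for i t
    by metis
  have "\<bar>x t $ i\<bar> \<le> Max (range c)" for t i
    by (rule order_trans[OF c]) simp
  then show "\<exists>c. \<forall>t i. \<bar>x t $ i\<bar> \<le> c" by blast
qed (auto simp: linf_def bounded_iff)

text \<open>Membership in \<open>linf\<close> bounds each channel above, so the suprema in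
  \<open>linf_norm\<close> are genuine.\<close>

lemma linf_norm_le_iff:
  assumes "x \<in> linf"
  shows "linf_norm x \<le> c \<longleftrightarrow> (\<forall>t i. \<bar>x t $ i\<bar> \<le> c)"
proof -
  have "bdd_above (range (\<lambda>t. \<bar>x t $ i\<bar>))" for i
    using assms by (auto simp: linf_iff bdd_above_def)
  then show ?thesis
    by (auto simp: linf_norm_def cSUP_le_iff)
qed

text \<open>Stability with causality left out, because the noncausal \<open>left_shift\<close> is
  one of the building blocks of the closed loop map. Allowing every radius \<open>c\<close> lets
  bounds be chained under composition.\<close>

definition bounded_op :: "('q::finite signal \<Rightarrow> 'p::finite signal) \<Rightarrow> bool" where
  "bounded_op T \<longleftrightarrow> linear_op_on UNIV T \<and>
     (\<forall>c. \<exists>K. \<forall>x. (\<forall>t i. \<bar>x t $ i\<bar> \<le> c) \<longrightarrow> (\<forall>t i. \<bar>T x t $ i\<bar> \<le> K))"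

lemma bounded_op_add: "bounded_op T \<Longrightarrow> T (x + y) = T x + T y"
  and bounded_op_scale: "bounded_op T \<Longrightarrow> T (\<lambda>t. c *\<^sub>R x t) = (\<lambda>t. c *\<^sub>R T x t)"
  by (auto simp: bounded_op_def linear_op_on_def)

lemma bounded_op_zero: "bounded_op T \<Longrightarrow> T 0 = 0"
  using bounded_op_add[of T 0 0] by simp

lemma bounded_op_diff: "bounded_op T \<Longrightarrow> T (x - y) = T x - T y"
  using bounded_op_add[of T "x - y" y] by (simp add: eq_diff_eq)

lemma bounded_opE:
  assumes "bounded_op T"
  obtains K where "\<And>x t i. (\<And>t i. \<bar>x t $ i\<bar> \<le> c) \<Longrightarrow> \<bar>T x t $ i\<bar> \<le> K"
  using assms unfolding bounded_op_def by metis

lemma bounded_opI: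
  assumes "\<And>x y t. T (x + y) t = T x t + T y t"
    and "\<And>c x t. T (\<lambda>t. c *\<^sub>R x t) t = c *\<^sub>R T x t"
    and "\<And>c. \<exists>K. \<forall>x t i. (\<forall>t i. \<bar>x t $ i\<bar> \<le> c) \<longrightarrow> \<bar>T x t $ i\<bar> \<le> K"
  shows "bounded_op T"
  unfolding bounded_op_def linear_op_on_def
proof (intro conjI ballI allI)
  fix c
  show "\<exists>K. \<forall>x. (\<forall>t i. \<bar>x t $ i\<bar> \<le> c) \<longrightarrow> (\<forall>t i. \<bar>T x t $ i\<bar> \<le> K)"
    using assms(3)[of c] by blast
qed (simp_all add: fun_eq_iff assms(1,2))

text \<open>\<open>finite_induced_norm\<close> speaks of the unit ball only; by linearity on
  \<open>linf\<close>, rescaling carries the bound to balls of any radius.\<close>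

lemma LTV_bounded:
  assumes R: "R \<in> LTV"
  shows "\<exists>K. \<forall>x t i. (\<forall>t i. \<bar>x t $ i\<bar> \<le> c) \<longrightarrow> \<bar>R x t $ i\<bar> \<le> K"
proof -
  have lin: "linear_op_on linf R" and mem: "\<And>x. x \<in> linf \<Longrightarrow> R x \<in> linf"
    using R by (auto simp: LTV_def)
  obtain M where M: "linf_norm (R x) \<le> M" if "x \<in> linf" "linf_norm x \<le> 1" for x
    using R by (auto simp: LTV_def finite_induced_norm_def bdd_above_def)
  \<comment> \<open>\<open>c\<close> is an arbitrary real, possibly zero or negative; dividing by
    \<open>k\<close> is always legitimate.\<close>
  define k where "k = \<bar>c\<bar> + 1"
  have k: "k > 0" by (simp add: k_def)
  have "\<bar>R x t $ i\<bar> \<le> k * M" if x: "\<forall>t i. \<bar>x t $ i\<bar> \<le> c" for x t i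
  proof -
    define y where "y = (\<lambda>t. (1 / k) *\<^sub>R x t)"
    have y1: "\<bar>y t $ i\<bar> \<le> 1" for t i
      using x[rule_format, of t i] k by (simp add: y_def abs_mult k_def field_simps)
    then have y: "y \<in> linf" by (auto simp: linf_iff)
    have "\<bar>R y t $ i\<bar> \<le> M"
      using M[OF y] y1 by (simp add: linf_norm_le_iff y mem)
    moreover have "x = (\<lambda>t. k *\<^sub>R y t)"
      using k by (simp add: y_def)
    then have "R x = (\<lambda>t. k *\<^sub>R R y t)"
      using lin y by (auto simp: linear_op_on_def)
    ultimately show ?thesis using k by (simp add: abs_mult)
  qed
  then show ?thesis by blast
qed

text \<open>Splits stability into a part that can be checked piece by piece and causality, which is
  checked only for the whole map.\<close>

lemma linf_stable_iff: "linf_stable T \<longleftrightarrow> bounded_op T \<and> causal_on UNIV T"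
proof
  assume T: "linf_stable T"
  then have "T \<in> LTV" by (simp add: linf_stable_LTV)
  from LTV_bounded[OF this] T show "bounded_op T \<and> causal_on UNIV T"
    unfolding bounded_op_def linf_stable_def by metis
next
  assume T: "bounded_op T \<and> causal_on UNIV T"
  have mem: "T x \<in> linf" if "x \<in> linf" for x
    using that T unfolding bounded_op_def linf_iff by metis
  obtain K where K: "\<And>x t i. (\<And>t i. \<bar>x t $ i\<bar> \<le> 1) \<Longrightarrow> \<bar>T x t $ i\<bar> \<le> K"
    using T bounded_opE by blast
  have "linf_norm (T x) \<le> K" if "x \<in> linf" "linf_norm x \<le> 1" for x
    using that K by (simp add: linf_norm_le_iff mem)
  then show "linf_stable T"
    using T mem by (auto simp: linf_stable_def bounded_op_def finite_induced_norm_def bdd_above_def)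
qed

section \<open>Extended operators and closure properties of bounded operators\<close>

lemma extend_cong: "(\<And>s. s \<le> t \<Longrightarrow> x s = y s) \<Longrightarrow> extend R x t = extend R y t"
  by (simp add: extend_def)

text \<open>Linearity on all signals comes from the pulse response formula; the bound comes from
  \<open>R\<close>, with which \<open>extend R\<close> agrees on \<open>linf\<close>.\<close>

lemma bounded_op_extend:
  assumes R: "R \<in> LTV"
  shows "bounded_op (extend R)"
proof (rule bounded_opI)
  fix c
  obtain K where K: "\<And>x t i. (\<And>t i. \<bar>x t $ i\<bar> \<le> c) \<Longrightarrow> \<bar>R x t $ i\<bar> \<le> K"
    using LTV_bounded[OF R] by metis
  then show "\<exists>K. \<forall>x t i. (\<forall>t i. \<bar>x t $ i\<bar> \<le> c) \<longrightarrow> \<bar>extend R x t $ i\<bar> \<le> K"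
    by (metis extend_eq[OF R] linf_iff)
qed (simp_all add: extend_def matrix_vector_right_distrib sum.distrib
       matrix_vector_mult_scaleR scaleR_right.sum)

lemma bounded_op_compose:
  assumes "bounded_op T" and "bounded_op U"
  shows "bounded_op (\<lambda>x. T (U x))"
proof (rule bounded_opI)
  fix c
  obtain K where K: "\<And>x t i. (\<And>t i. \<bar>x t $ i\<bar> \<le> c) \<Longrightarrow> \<bar>U x t $ i\<bar> \<le> K"
    using assms(2) bounded_opE by blast
  obtain M where "\<And>x t i. (\<And>t i. \<bar>x t $ i\<bar> \<le> K) \<Longrightarrow> \<bar>T x t $ i\<bar> \<le> M"
    using assms(1) bounded_opE by blast
  with K show "\<exists>K. \<forall>x t i. (\<forall>t i. \<bar>x t $ i\<bar> \<le> c) \<longrightarrow> \<bar>T (U x) t $ i\<bar> \<le> K"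
    by blast
qed (simp_all add: assms[THEN bounded_op_add] assms[THEN bounded_op_scale])

lemma bounded_op_plus:
  assumes "bounded_op T" and "bounded_op U"
  shows "bounded_op (\<lambda>x. T x + U x)"
proof (rule bounded_opI)
  fix c
  obtain K where K: "\<And>x t i. (\<And>t i. \<bar>x t $ i\<bar> \<le> c) \<Longrightarrow> \<bar>U x t $ i\<bar> \<le> K"
    using assms(2) bounded_opE by blast
  obtain M where M: "\<And>x t i. (\<And>t i. \<bar>x t $ i\<bar> \<le> c) \<Longrightarrow> \<bar>T x t $ i\<bar> \<le> M"
    using assms(1) bounded_opE by blast
  have "\<bar>(T x + U x) t $ i\<bar> \<le> M + K" if "\<forall>t i. \<bar>x t $ i\<bar> \<le> c" for x t i
    using that M[of x t i] K[of x t i] by simp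
  then show "\<exists>K. \<forall>x t i. (\<forall>t i. \<bar>x t $ i\<bar> \<le> c) \<longrightarrow> \<bar>(T x + U x) t $ i\<bar> \<le> K"
    by blast
qed (simp_all add: assms[THEN bounded_op_add] assms[THEN bounded_op_scale] scaleR_add_right)

lemma bounded_op_minus:
  fixes T U :: "'q::finite signal \<Rightarrow> 'p::finite signal"
  assumes "bounded_op T" and "bounded_op U"
  shows "bounded_op (\<lambda>x. T x - U x)"
proof -
  have "bounded_op (\<lambda>x. - x :: 'p signal)"
    by (rule bounded_opI) auto
  from bounded_op_plus[OF assms(1) bounded_op_compose[OF this assms(2)]] show ?thesis
    by simp
qed

lemma bounded_op_stack:
  assumes "bounded_op T" and "bounded_op U"
  shows "bounded_op (\<lambda>x. stack (T x) (U x))"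
proof (rule bounded_opI)
  fix c
  obtain K where K: "\<And>x t i. (\<And>t i. \<bar>x t $ i\<bar> \<le> c) \<Longrightarrow> \<bar>U x t $ i\<bar> \<le> K"
    using assms(2) bounded_opE by blast
  obtain M where M: "\<And>x t i. (\<And>t i. \<bar>x t $ i\<bar> \<le> c) \<Longrightarrow> \<bar>T x t $ i\<bar> \<le> M"
    using assms(1) bounded_opE by blast
  have "\<bar>stack (T x) (U x) t $ i\<bar> \<le> max M K" if "\<forall>t i. \<bar>x t $ i\<bar> \<le> c" for x t i
    using that by (auto simp: stack_def le_max_iff_disj M K split: sum.split)
  then show "\<exists>K. \<forall>x t i. (\<forall>t i. \<bar>x t $ i\<bar> \<le> c) \<longrightarrow> \<bar>stack (T x) (U x) t $ i\<bar> \<le> K"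
    by blast
qed (simp_all add: assms[THEN bounded_op_add] assms[THEN bounded_op_scale] stack_def vec_eq_iff split: sum.split)

text \<open>Shifts and projections only copy entries or insert zeros, so they create no larger
  values.\<close>

lemma bounded_op_selection:
  assumes "\<And>x y t. T (x + y) t = T x t + T y t"
    and "\<And>c x t. T (\<lambda>t. c *\<^sub>R x t) t = c *\<^sub>R T x t"
    and sel: "\<And>x t i. T x t $ i = 0 \<or> (\<exists>s j. T x t $ i = x s $ j)"
  shows "bounded_op T"
proof (rule bounded_opI)
  fix c :: real
  have "\<bar>T x t $ i\<bar> \<le> max c 0" if "\<forall>t i. \<bar>x t $ i\<bar> \<le> c" for x t i
    using sel[where x = x and t = t and i = i]
  proof
    assume "\<exists>s j. T x t $ i = x s $ j"
    then show ?thesis using that by (metis max.coboundedI1)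
  qed simp
  then show "\<exists>K. \<forall>x t i. (\<forall>t i. \<bar>x t $ i\<bar> \<le> c) \<longrightarrow> \<bar>T x t $ i\<bar> \<le> K"
    by blast
qed fact+

lemma bounded_op_upper: "bounded_op upper"
  by (rule bounded_op_selection) (auto simp: upper_def vec_eq_iff)

lemma bounded_op_lower: "bounded_op lower"
  by (rule bounded_op_selection) (auto simp: lower_def vec_eq_iff)

lemma bounded_op_left_shift: "bounded_op left_shift"
  by (rule bounded_op_selection) (auto simp: left_shift_def)

lemma bounded_op_right_shift: "bounded_op right_shift"
  by (rule bounded_op_selection) (auto simp: right_shift_def split: nat.split)

text \<open>Composition enters with a fixed outer operator, since the general rule can match a goal
  in several ways.\<close>

lemmas bounded_op_intros =
  bounded_op_plus bounded_op_minus bounded_op_stack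
  bounded_op_upper bounded_op_lower
  bounded_op_compose[OF bounded_op_lower] bounded_op_compose[OF bounded_op_upper]
  bounded_op_compose[OF bounded_op_left_shift] bounded_op_compose[OF bounded_op_right_shift]

section \<open>Shift identities and behaviour at time 0\<close>

lemma right_shift_0 [simp]: "right_shift x 0 = 0"
  and right_shift_Suc [simp]: "right_shift x (Suc t) = x t"
  by (simp_all add: right_shift_def)

lemma left_shift_right_shift [simp]: "left_shift (right_shift x) = x"
  by (simp add: left_shift_def)

lemma right_shift_left_shift_apply: "right_shift (left_shift x) t = (if t = 0 then 0 else x t)"
  by (cases t) (simp_all add: left_shift_def)

text \<open>No time precedes 0, so the output there is the same for all inputs, in particular for
  the zero signal.\<close>

lemma strictly_causal_zero:
  assumes "bounded_op T" and "strictly_causal_on UNIV T"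
  shows "T x 0 = 0"
proof -
  have "T x 0 = T 0 0"
    using assms(2)[unfolded strictly_causal_on_def, rule_format, of x 0 0] by simp
  then show ?thesis by (simp add: bounded_op_zero[OF assms(1)])
qed

section \<open>Explicit solution of the perturbed closed loop and its stability\<close>

text \<open>The signal that \<open>left_shift wh\<close> must equal: the disturbance as
  reconstructed by the controller.\<close>

definition innovation ::
    "('n::finite signal \<Rightarrow> 'n signal) \<Rightarrow> ('p::finite signal \<Rightarrow> 'n signal) \<Rightarrow>
     'n signal \<Rightarrow> 'n signal \<Rightarrow> 'p signal \<Rightarrow> 'n signal" where
  "innovation A B w \<delta>y \<delta>u =
     w + left_shift \<delta>y - extend A (right_shift (left_shift \<delta>y)) + extend B \<delta>u"

text \<open>The bound \<open>Suc t\<close> records the one-step lookahead caused by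
  \<open>left_shift \<delta>y\<close>.\<close>

lemma innovation_cong:
  assumes "\<And>s. s \<le> Suc t \<Longrightarrow> w s = w' s \<and> \<delta>y s = \<delta>y' s \<and> \<delta>u s = \<delta>u' s"
  shows "innovation A B w \<delta>y \<delta>u t = innovation A B w' \<delta>y' \<delta>u' t"
proof -
  have "extend A (right_shift (left_shift \<delta>y)) t = extend A (right_shift (left_shift \<delta>y')) t"
    "extend B \<delta>u t = extend B \<delta>u' t"
    using assms by (auto intro!: extend_cong simp: right_shift_left_shift_apply)
  then show ?thesis
    using assms[of t] assms[of "Suc t"] by (simp add: innovation_def left_shift_def)
qed

text \<open>Stated as an equivalence so that one direction yields uniqueness and the other
  existence.\<close>

lemma interconnection_solution:
  fixes A :: "'n::finite signal \<Rightarrow> 'n signal"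
    and B :: "'p::finite signal \<Rightarrow> 'n signal"
  assumes A: "A \<in> LTV" and B: "B \<in> LTV"
    and \<Phi>x: "bounded_op \<Phi>x" "strictly_causal_on UNIV \<Phi>x"
    and eq: "\<And>z. (\<Phi>x z - right_shift (extend A (\<Phi>x z))) + - right_shift (extend B (\<Phi>u z))
              = right_shift z"
  defines "z \<equiv> innovation A B"
  shows "interconnection A B \<Phi>x \<Phi>u w \<delta>y \<delta>u x u wh \<longleftrightarrow>
    x = \<Phi>x (z w \<delta>y \<delta>u) - right_shift (left_shift \<delta>y) \<and>
    u = \<Phi>u (z w \<delta>y \<delta>u) + \<delta>u \<and> wh = right_shift (z w \<delta>y \<delta>u)"
    (is "_ \<longleftrightarrow> ?sol")
proof -
  note lin = bounded_op_add[OF bounded_op_extend[OF A]] bounded_op_diff[OF bounded_op_extend[OF A]]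
    bounded_op_add[OF bounded_op_extend[OF B]]
    bounded_op_add[OF bounded_op_right_shift] bounded_op_diff[OF bounded_op_right_shift]
  define \<delta> where "\<delta> = right_shift (left_shift \<delta>y)"
  have shift_z: "right_shift (z w \<delta>y \<delta>u) =
      right_shift w + \<delta> - right_shift (extend A \<delta>) + right_shift (extend B \<delta>u)"
    by (simp add: z_def innovation_def lin \<delta>_def)
  have eq': "\<Phi>x y = right_shift (extend A (\<Phi>x y)) + right_shift (extend B (\<Phi>u y)) + right_shift y" for y
    using eq[of y] by (simp add: algebra_simps)
  have zero: "\<Phi>x y 0 = 0" for y
    by (rule strictly_causal_zero[OF \<Phi>x])
  show ?thesis
  proof
    assume ic: "interconnection A B \<Phi>x \<Phi>u w \<delta>y \<delta>u x u wh"
    define y where "y = left_shift wh"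
    from ic have x: "x = right_shift (extend A x) + right_shift (extend B u) + right_shift w"
      and x0: "x 0 = 0" and u: "u = \<Phi>u y + \<delta>u" and wh0: "wh 0 = 0"
      and wh: "\<forall>t\<ge>1. wh t = x t + \<delta>y t + (wh t - \<Phi>x y t)"
      unfolding interconnection_iff y_def by blast+
    from wh have "\<Phi>x y t = x t + \<delta>y t" if "t > 0" for t
      using that by (simp add: algebra_simps)
    \<comment> \<open>The controller equation covers only positive times. At time 0 all three
      signals vanish, which is why \<open>\<delta>\<close> stands here and not
      \<open>\<delta>y\<close>.\<close>
    then have \<Phi>: "\<Phi>x y = x + \<delta>"
      by (auto simp: fun_eq_iff \<delta>_def right_shift_left_shift_apply zero x0)
    have w: "right_shift w = x - (right_shift (extend A x) + right_shift (extend B u))"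
      using x by (metis add_diff_cancel_left')
    \<comment> \<open>The left side is rewritten by the constraint, the right side by
      \<open>shift_z\<close> and the plant equation; linearity then cancels the
      \<open>\<delta>u\<close> terms.\<close>
    have "right_shift y = right_shift (z w \<delta>y \<delta>u)"
      unfolding shift_z w eq[of y, symmetric] \<Phi> u by (simp add: lin)
    then have "y = z w \<delta>y \<delta>u"
      by (metis left_shift_right_shift)
    moreover have "wh = right_shift y"
      by (auto simp: fun_eq_iff y_def right_shift_left_shift_apply wh0)
    ultimately show ?sol
      using \<Phi> u by (auto simp: \<delta>_def)
  next
    assume s: ?sol
    define y where "y = z w \<delta>y \<delta>u"
    from s have x: "x = \<Phi>x y - \<delta>" and u: "u = \<Phi>u y + \<delta>u" and wh: "wh = right_shift y"
      by (simp_all add: y_def \<delta>_def)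
    \<comment> \<open>The plant equation: the constraint at \<open>y\<close>, with
      \<open>right_shift y\<close> expanded by \<open>shift_z\<close>.\<close>
    have "\<Phi>x y - \<delta> = right_shift (extend A (\<Phi>x y - \<delta>)) + right_shift (extend B (\<Phi>u y + \<delta>u)) + right_shift w"
      using eq'[of y] shift_z[folded y_def] by (simp add: lin algebra_simps)
    then show "interconnection A B \<Phi>x \<Phi>u w \<delta>y \<delta>u x u wh"
      unfolding interconnection_iff x u wh
      by (auto simp: zero \<delta>_def right_shift_left_shift_apply)
  qed
qed

theorem proposition3p4:
  fixes A :: "'n::finite signal \<Rightarrow> 'n signal"
    and B :: "'p::finite signal \<Rightarrow> 'n signal"
    and \<Phi>x :: "'n signal \<Rightarrow> 'n signal"
    and \<Phi>u :: "'n signal \<Rightarrow> 'p signal"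
  assumes "A \<in> LTV" and "B \<in> LTV"
    and "linf_stable \<Phi>x" and "strictly_causal_on UNIV \<Phi>x"
    and "linf_stable \<Phi>u" and "strictly_causal_on UNIV \<Phi>u"
    and "\<forall>z. (\<Phi>x z - right_shift (extend A (\<Phi>x z))) + - right_shift (extend B (\<Phi>u z))
              = right_shift z"
  shows "linf_stabilizing A B \<Phi>x \<Phi>u
    \<and> linf_stable (closed_loop_map A B \<Phi>x \<Phi>u)
    \<and> (\<forall>w x u wh. interconnection A B \<Phi>x \<Phi>u w 0 0 x u wh \<longrightarrow> x = \<Phi>x w \<and> u = \<Phi>u w)"
proof -
  have \<Phi>x: "bounded_op \<Phi>x" and \<Phi>u: "bounded_op \<Phi>u"
    using assms by (auto simp: linf_stable_iff)
  note A = bounded_op_extend[OF assms(1)] and B = bounded_op_extend[OF assms(2)]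
  note sol = interconnection_solution[OF assms(1,2) \<Phi>x assms(4) assms(7)[rule_format]]
  define z where "z = (\<lambda>d. innovation A B (upper d) (upper (lower d)) (lower (lower d)))"
  \<comment> \<open>By \<open>sol\<close>, the interconnection is the graph of an explicit function
    of the inputs.\<close>
  have wp: "well_posed A B \<Phi>x \<Phi>u"
    unfolding well_posed_def sol by (auto simp: case_prod_unfold prod_eq_iff)
  have cl: "closed_loop_map A B \<Phi>x \<Phi>u =
      (\<lambda>d. stack (\<Phi>x (z d) - right_shift (left_shift (upper (lower d))))
             (stack (\<Phi>u (z d) + lower (lower d)) (right_shift (z d))))"
    (is "_ = ?T")
  proof
    fix d
    have "(THE (x, u, wh). interconnection A B \<Phi>x \<Phi>u
        (upper d) (upper (lower d)) (lower (lower d)) x u wh) =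
        (\<Phi>x (z d) - right_shift (left_shift (upper (lower d))),
         \<Phi>u (z d) + lower (lower d), right_shift (z d))"
      by (rule the_equality) (auto simp: sol z_def)
    then show "closed_loop_map A B \<Phi>x \<Phi>u d = ?T d"
      by (simp add: closed_loop_map_def)
  qed
  have z: "bounded_op z"
    unfolding z_def innovation_def
    by (intro bounded_op_intros bounded_op_compose[OF A] bounded_op_compose[OF B])
  have "bounded_op ?T"
    by (intro bounded_op_intros bounded_op_compose[OF \<Phi>x] bounded_op_compose[OF \<Phi>u] z)
  moreover have "causal_on UNIV ?T"
    unfolding causal_on_def
  proof safe
    fix d e :: "('n + 'n + 'p) signal" and t :: nat
    assume de: "\<forall>s\<le>t. d s = e s"
    \<comment> \<open>The lookahead costs one step: inputs agreeing up to \<open>t\<close> give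
      agreement of \<open>z\<close> strictly before \<open>t\<close>. This is exactly what
      \<open>\<Phi>x\<close>, \<open>\<Phi>u\<close> and \<open>right_shift\<close> require at time
      \<open>t\<close>.\<close>
    have ze: "\<forall>s<t. z d s = z e s"
      unfolding z_def using de
      by (auto intro!: innovation_cong simp: upper_def lower_def)
    then have "\<Phi>x (z d) t = \<Phi>x (z e) t" "\<Phi>u (z d) t = \<Phi>u (z e) t"
      using assms(4,6) unfolding strictly_causal_on_def by blast+
    moreover have "right_shift (z d) t = right_shift (z e) t"
      using ze by (cases t) auto
    ultimately show "?T d t = ?T e t"
      using de by (simp add: stack_def right_shift_left_shift_apply upper_def lower_def)
  qed
  ultimately have st: "linf_stable (closed_loop_map A B \<Phi>x \<Phi>u)"
    by (simp add: linf_stable_iff cl)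
  \<comment> \<open>Without perturbations the controller reconstructs the disturbance exactly, so
    the solution formulas reduce to the claimed response.\<close>
  have "innovation A B w 0 0 = w" for w
    by (simp add: innovation_def bounded_op_zero[OF A] bounded_op_zero[OF B]
        bounded_op_zero[OF bounded_op_left_shift] bounded_op_zero[OF bounded_op_right_shift])
  then have "x = \<Phi>x w \<and> u = \<Phi>u w" if "interconnection A B \<Phi>x \<Phi>u w 0 0 x u wh" for w x u wh
    using that unfolding sol
    by (simp add: bounded_op_zero[OF bounded_op_left_shift] bounded_op_zero[OF bounded_op_right_shift])
  with wp st show ?thesis
    by (simp add: linf_stabilizing_def)
qed

end
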